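(* Let $T$ be a tournament with vertex set $[n]$ and let $\{X,Y\}$ be a bipartition of $[n]$. Then $\{X,Y\}$ is a bi-join of $T$ if and only if $\{X,Y\}$ is an HL-bipartition of the Seidel adjacency matrix $S(T)$.
   Context: $[n]:=\{1,\dots,n\}$. A bipartition of a set $V$ is an unordered partition $\{X,Y\}$ of $V$ into two nonempty parts. A tournament is a directed graph (without loops) such that for all distinct vertices $x,y$, either $x\to y$ or $y\to x$, and never both. $N_T^+(x)=\{y: x\to y\}$ and $N_T^-(x)=\{y: y\to x\}$. A bipartition $\{X,Y\}$ of the vertex set is a bi-join of $T$ if there exist (possibly empty) $X_1\subseteq X$ and $Y_1\subseteq Y$ such that for all $x\in X_1$, $N_T^+(x)\cap Y=Y_1$ and $N_T^-(x)\cap Y=Y\setminus Y_1$, and for all $x\in X\setminus X_1$, $N_T^+(x)\cap Y=Y\setminus Y_1$ and $N_T^-(x)\cap Y=Y_1$. The Seidel adjacency matrix $S(T)=[s_{ij}]$ is the real $n\times n$ matrix with $s_{ii}=0$ and, for $i\neq j$, $s_{ij}=-1$ if $i\to j$ and $s_{ij}=+1$ otherwise. For an $n\times n$ matrix $M$, $M[X,Y]$ denotes the submatrix with row indices in $X$ and column indices in $Y$. An HL-bipartition of $M$ is a bipartition $\{X,Y\}$ of $[n]$ such that both $M[X,Y]$ and $M[Y,X]$ have rank at most $1$. *)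

theory Defs
  imports
    "Graph_Theory.Pair_Digraph"
    "Jordan_Normal_Form.DL_Rank"
    "Jordan_Normal_Form.DL_Submatrix"
    "HOL-Library.Disjoint_Sets"
begin

definition bipartition :: "'a set \<Rightarrow> 'a set \<Rightarrow> 'a set \<Rightarrow> bool" where
  "bipartition V X Y \<longleftrightarrow> partition_on V {X, Y} \<and> X \<noteq> Y"

locale tournament = pair_loopfree_digraph T for T :: "'a pair_pre_digraph" +
  assumes arc_xor: "\<lbrakk>x \<in> pverts T; y \<in> pverts T; x \<noteq> y\<rbrakk> \<Longrightarrow>
    ((x, y) \<in> parcs T \<or> (y, x) \<in> parcs T) \<and> \<not> ((x, y) \<in> parcs T \<and> (y, x) \<in> parcs T)"

definition out_nbhd :: "'a pair_pre_digraph \<Rightarrow> 'a \<Rightarrow> 'a set" where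
  "out_nbhd T x = {y. (x, y) \<in> parcs T}"

definition in_nbhd :: "'a pair_pre_digraph \<Rightarrow> 'a \<Rightarrow> 'a set" where
  "in_nbhd T x = {y. (y, x) \<in> parcs T}"

text \<open>The parts are passed as an ordered pair, although a bipartition is unordered. For tournaments
  the condition below is symmetric in \<open>X\<close> and \<open>Y\<close>.\<close>

definition bi_join :: "'a pair_pre_digraph \<Rightarrow> 'a set \<Rightarrow> 'a set \<Rightarrow> bool" where
  "bi_join T X Y \<longleftrightarrow> bipartition (pverts T) X Y \<and>
    (\<exists>X\<^sub>1 Y\<^sub>1. X\<^sub>1 \<subseteq> X \<and> Y\<^sub>1 \<subseteq> Y \<and>
      (\<forall>x\<in>X\<^sub>1. out_nbhd T x \<inter> Y = Y\<^sub>1 \<and> in_nbhd T x \<inter> Y = Y - Y\<^sub>1) \<and>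
      (\<forall>x\<in>X - X\<^sub>1. out_nbhd T x \<inter> Y = Y - Y\<^sub>1 \<and> in_nbhd T x \<inter> Y = Y\<^sub>1))"

text \<open>Vertices and index sets range over \<open>{1..n}\<close>, whereas matrix entries are addressed from
  \<open>0\<close>: entry \<open>(i, j)\<close> below belongs to the vertices \<open>Suc i\<close> and \<open>Suc j\<close>.\<close>

definition seidel_mat :: "nat \<Rightarrow> nat pair_pre_digraph \<Rightarrow> real mat" where
  "seidel_mat n T = mat n n (\<lambda>(i, j).
    if i = j then 0 else if (Suc i, Suc j) \<in> parcs T then - 1 else 1)"

definition block :: "'a mat \<Rightarrow> nat set \<Rightarrow> nat set \<Rightarrow> 'a mat" where
  "block M X Y = submatrix M (Suc -` X) (Suc -` Y)"

definition mat_rank :: "'a :: field mat \<Rightarrow> nat" where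
  "mat_rank M = vec_space.rank (dim_row M) M"

text \<open>Intended for square \<open>M\<close>.\<close>

definition HL_bipartition :: "'a :: field mat \<Rightarrow> nat set \<Rightarrow> nat set \<Rightarrow> bool" where
  "HL_bipartition M X Y \<longleftrightarrow> bipartition {1..dim_row M} X Y \<and>
    mat_rank (block M X Y) \<le> 1 \<and> mat_rank (block M Y X) \<le> 1"

end

theory Submission
  imports Defs "Jordan_Normal_Form.DL_Rank_Submatrix"
begin

text \<open>Both sides of the equivalence say that the arcs between the two parts have a product form.
  A matrix has rank at most \<open>1\<close> iff its \<open>2 \<times> 2\<close> minors vanish
  (\<open>mat_rank_le_1_iff_minors_zero\<close>). For entries \<open>\<plusminus>1\<close> the vanishing of a minor is a parity condition:
  on the four arcs joining \<open>x, x'\<close> to \<open>y, y'\<close>, the vertices \<open>y\<close> and \<open>y'\<close> agree on whether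
  \<open>x\<close> and \<open>x'\<close> treat them alike. By \<open>agreement_iff_product_form\<close>, this holds for all
  quadruples iff the direction of the arc between \<open>x\<close> and \<open>y\<close> is the equivalence of a condition on
  \<open>x\<close> and one on \<open>y\<close>; in a tournament, that is what the sets \<open>X\<^sub>1\<close> and \<open>Y\<^sub>1\<close> of a bi-join express
  (\<open>bi_join_iff_agreement\<close>).

  Both off-diagonal blocks give the same parity conditions, since reversing all four arcs
  of a quadruple does not change the parity.\<close>

section \<open>Matrices of rank at most one\<close>

lemma det_2_by_2:
  fixes A :: "'a :: comm_ring_1 mat"
  assumes "A \<in> carrier_mat 2 2"
  shows "det A = A $$ (0, 0) * A $$ (1, 1) - A $$ (0, 1) * A $$ (1, 0)"
proof -
  have "det A = (\<Sum>i<2. A $$ (i, 0) * cofactor A i 0)"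
    using laplace_expansion_column[OF assms, of 0] by simp
  moreover have "mat_delete A 0 0 \<in> carrier_mat 1 1" "mat_delete A 1 0 \<in> carrier_mat 1 1"
    using assms by (auto simp: mat_delete_def)
  ultimately show ?thesis
    using assms by (simp add: numeral_2_eq_2 cofactor_def det_single) (simp add: mat_delete_def)
qed

lemma pick_two:
  assumes "a < b"
  shows "pick {a, b} 0 = a" "pick {a, b} 1 = b"
proof -
  show *: "pick {a, b} 0 = a"
    using assms by (auto intro!: Least_equality)
  have "pick {a, b} 1 = (LEAST x. x \<in> {a, b} \<and> a < x)"
    using * by (simp add: One_nat_def)
  also have "\<dots> = b"
    using assms by (auto intro!: Least_equality)
  finally show "pick {a, b} 1 = b" .
qed

lemma minor_nonzero_imp_mat_rank_ge_2:
  fixes A :: "'a :: field mat"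
  assumes "i < i'" "i' < dim_row A" "j < j'" "j' < dim_col A"
    and "A $$ (i, j) * A $$ (i', j') \<noteq> A $$ (i, j') * A $$ (i', j)"
  shows "mat_rank A \<ge> 2"
proof -
  let ?N = "submatrix A {i, i'} {j, j'}"
  have "{k. k < dim_row A \<and> k \<in> {i, i'}} = {i, i'}" "{k. k < dim_col A \<and> k \<in> {j, j'}} = {j, j'}"
    using assms by auto
  then have card: "card {k. k < dim_row A \<and> k \<in> {i, i'}} = 2"
      "card {k. k < dim_col A \<and> k \<in> {j, j'}} = 2"
    using assms by auto
  then have N: "?N \<in> carrier_mat 2 2"
    by (auto simp: dim_submatrix)
  have entry: "?N $$ (r, c) = A $$ (pick {i, i'} r, pick {j, j'} c)" if "r < 2" "c < 2" for r c
    using submatrix_index[of r A "{i, i'}" c "{j, j'}"] that card by simp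
  have "det ?N = A $$ (i, j) * A $$ (i', j') - A $$ (i, j') * A $$ (i', j)"
    unfolding det_2_by_2[OF N] using pick_two[OF assms(1)] pick_two[OF assms(3)]
    by (simp add: entry del: pick.simps One_nat_def)
  then have "det ?N \<noteq> 0"
    using assms(5) by simp
  then show ?thesis
    unfolding mat_rank_def card(2)[symmetric]
    by (rule vec_space.rank_gt_minor[OF carrier_matI[OF refl refl]])
qed

lemma mat_rank_le_1_iff_minors_zero:
  fixes A :: "'a :: field mat"
  shows "mat_rank A \<le> 1 \<longleftrightarrow>
    (\<forall>i<dim_row A. \<forall>i'<dim_row A. \<forall>j<dim_col A. \<forall>j'<dim_col A.
      A $$ (i, j) * A $$ (i', j') = A $$ (i, j') * A $$ (i', j))" (is "_ \<longleftrightarrow> ?minors")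
proof
  assume rank: "mat_rank A \<le> 1"
  have minor: "A $$ (i, j) * A $$ (i', j') = A $$ (i, j') * A $$ (i', j)"
    if "i < i'" "i' < dim_row A" "j < j'" "j' < dim_col A" for i i' j j'
    using minor_nonzero_imp_mat_rank_ge_2[OF that] rank by fastforce
  have minor_rows: "A $$ (i, j) * A $$ (i', j') = A $$ (i, j') * A $$ (i', j)"
    if "i < i'" "i' < dim_row A" "j < dim_col A" "j' < dim_col A" for i i' j j'
    using minor[OF that(1,2), of j j'] minor[OF that(1,2), of j' j] that
    by (cases j j' rule: linorder_cases) auto
  show ?minors
  proof (intro allI impI)
    fix i i' j j'
    assume "i < dim_row A" "i' < dim_row A" "j < dim_col A" "j' < dim_col A"
    then show "A $$ (i, j) * A $$ (i', j') = A $$ (i, j') * A $$ (i', j)"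
      using minor_rows[of i i' j j'] minor_rows[of i' i j' j]
      by (cases i i' rule: linorder_cases) (auto simp: mult.commute)
  qed
next
  assume minors: ?minors
  (* A is the outer product of column q and row p, normalised by the nonzero entry (p, q). *)
  have "\<exists>f g. \<forall>r<dim_row A. \<forall>c<dim_col A. A $$ (r, c) = f r * g c"
  proof (cases "\<exists>p<dim_row A. \<exists>q<dim_col A. A $$ (p, q) \<noteq> 0")
    case True
    then obtain p q where pq: "p < dim_row A" "q < dim_col A" "A $$ (p, q) \<noteq> 0"
      by blast
    then have "\<forall>r<dim_row A. \<forall>c<dim_col A. A $$ (r, c) = A $$ (r, q) * (A $$ (p, c) / A $$ (p, q))"
      using minors by (simp add: field_simps)
    then show ?thesis
      by (intro exI)
  next
    case False
    then show ?thesis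
      by (intro exI[of _ "\<lambda>_. 0"]) simp
  qed
  then obtain f g where "\<And>r c. r < dim_row A \<Longrightarrow> c < dim_col A \<Longrightarrow> A $$ (r, c) = f r * g c"
    by blast
  then show "mat_rank A \<le> 1"
    unfolding mat_rank_def by (rule vec_space.rank_le_1_product_entries[OF carrier_matI[OF refl refl]])
qed

lemma pick_image:
  assumes "finite I"
  shows "pick I ` {..<card I} = I"
proof
  show "pick I ` {..<card I} \<subseteq> I"
    by (auto intro: pick_in_set_le)
  show "I \<subseteq> pick I ` {..<card I}"
  proof
    fix i assume i: "i \<in> I"
    then have "card {a \<in> I. a < i} < card I"
      using assms by (intro psubset_card_mono) auto
    then show "i \<in> pick I ` {..<card I}"
      by (intro image_eqI[where x = "card {a \<in> I. a < i}"]) (simp_all add: pick_card_in_set[OF i])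
  qed
qed

lemma mat_rank_submatrix_le_1_iff:
  fixes A :: "'a :: field mat"
  assumes "I \<subseteq> {..<dim_row A}" "J \<subseteq> {..<dim_col A}"
  shows "mat_rank (submatrix A I J) \<le> 1 \<longleftrightarrow>
    (\<forall>i\<in>I. \<forall>i'\<in>I. \<forall>j\<in>J. \<forall>j'\<in>J. A $$ (i, j) * A $$ (i', j') = A $$ (i, j') * A $$ (i', j))"
proof -
  have I: "{k. k < dim_row A \<and> k \<in> I} = I" and J: "{k. k < dim_col A \<and> k \<in> J} = J"
    using assms by auto
  have "finite I" "finite J"
    using assms finite_subset by blast+
  then have ball: "(\<forall>i\<in>I. P i) \<longleftrightarrow> (\<forall>r<card I. P (pick I r))"
      "(\<forall>j\<in>J. P j) \<longleftrightarrow> (\<forall>c<card J. P (pick J c))" for P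
    using pick_image[of I] pick_image[of J] by (metis (no_types, lifting) imageE imageI lessThan_iff)+
  show ?thesis
    unfolding mat_rank_le_1_iff_minors_zero dim_submatrix I J ball
    by (simp add: submatrix_index I J)
qed

section \<open>Blocks of the Seidel matrix\<close>

text \<open>The entries are \<open>\<plusminus>1\<close>, so a product of two entries records whether they are equal.\<close>

lemma rank_block_seidel_mat_le_1_iff:
  assumes "X \<subseteq> {1..n}" "Y \<subseteq> {1..n}" "X \<inter> Y = {}"
  shows "mat_rank (block (seidel_mat n T) X Y) \<le> 1 \<longleftrightarrow>
    (\<forall>x\<in>X. \<forall>x'\<in>X. \<forall>y\<in>Y. \<forall>y'\<in>Y.
      ((x, y) \<in> parcs T \<longleftrightarrow> (x', y) \<in> parcs T) \<longleftrightarrow> ((x, y') \<in> parcs T \<longleftrightarrow> (x', y') \<in> parcs T))"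
proof -
  let ?S = "seidel_mat n T" and ?s = "\<lambda>x y. if (x, y) \<in> parcs T then - 1 else 1 :: real"
  have ball: "(\<forall>i\<in>Suc -` Z. P (Suc i)) \<longleftrightarrow> (\<forall>z\<in>Z. P z)" if "Z \<subseteq> {1..n}" for Z P
  proof -
    have "Suc ` (Suc -` Z) = Z"
      using that by (auto simp: image_iff) (metis atLeastAtMost_iff Suc_le_D One_nat_def subsetD)
    then show ?thesis
      by (metis (no_types, lifting) ball_simps(9))
  qed
  have sub: "Suc -` X \<subseteq> {..<dim_row ?S}" "Suc -` Y \<subseteq> {..<dim_col ?S}"
    using assms by (auto simp: seidel_mat_def)
  have entry: "?S $$ (i, j) = ?s (Suc i) (Suc j)" if "i \<in> Suc -` X" "j \<in> Suc -` Y" for i j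
  proof -
    have "i < n" "j < n" "i \<noteq> j"
      using that assms by auto
    then show ?thesis
      by (simp add: seidel_mat_def)
  qed
  have "mat_rank (block ?S X Y) \<le> 1 \<longleftrightarrow>
    (\<forall>i\<in>Suc -` X. \<forall>i'\<in>Suc -` X. \<forall>j\<in>Suc -` Y. \<forall>j'\<in>Suc -` Y.
      ?s (Suc i) (Suc j) * ?s (Suc i') (Suc j') = ?s (Suc i) (Suc j') * ?s (Suc i') (Suc j))"
    unfolding block_def mat_rank_submatrix_le_1_iff[OF sub]
    by (intro ball_cong refl) (simp only: entry)
  also have "\<dots> \<longleftrightarrow> (\<forall>x\<in>X. \<forall>x'\<in>X. \<forall>y\<in>Y. \<forall>y'\<in>Y. ?s x y * ?s x' y' = ?s x y' * ?s x' y)"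
    unfolding ball[OF assms(1), symmetric] ball[OF assms(2), symmetric] ..
  also have "\<dots> \<longleftrightarrow> (\<forall>x\<in>X. \<forall>x'\<in>X. \<forall>y\<in>Y. \<forall>y'\<in>Y.
      ((x, y) \<in> parcs T \<longleftrightarrow> (x', y) \<in> parcs T) \<longleftrightarrow> ((x, y') \<in> parcs T \<longleftrightarrow> (x', y') \<in> parcs T))"
    by (intro ball_cong refl) auto
  finally show ?thesis .
qed

section \<open>Bi-joins\<close>

text \<open>A fixed row \<open>a\<close> gives the witnesses: the rows equal to row \<open>a\<close>, and the columns where
  row \<open>a\<close> is true. Every other row differs from row \<open>a\<close> somewhere, hence everywhere.\<close>

lemma agreement_iff_product_form:
  "(\<forall>x\<in>X. \<forall>x'\<in>X. \<forall>y\<in>Y. \<forall>y'\<in>Y. (R x y \<longleftrightarrow> R x' y) \<longleftrightarrow> (R x y' \<longleftrightarrow> R x' y')) \<longleftrightarrow>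
   (\<exists>X\<^sub>1 Y\<^sub>1. X\<^sub>1 \<subseteq> X \<and> Y\<^sub>1 \<subseteq> Y \<and> (\<forall>x\<in>X. \<forall>y\<in>Y. R x y \<longleftrightarrow> (x \<in> X\<^sub>1 \<longleftrightarrow> y \<in> Y\<^sub>1)))"
  (is "?agree \<longleftrightarrow> ?product")
proof
  assume agree: ?agree
  show ?product
  proof (cases "X = {}")
    case False
    then obtain a where a: "a \<in> X"
      by blast
    have "R x y \<longleftrightarrow> (x \<in> {x \<in> X. \<forall>y\<in>Y. R x y \<longleftrightarrow> R a y} \<longleftrightarrow> y \<in> {y \<in> Y. R a y})"
      if "x \<in> X" "y \<in> Y" for x y
      using agree a that by blast
    then show ?thesis
      by (intro exI[of _ "{x \<in> X. \<forall>y\<in>Y. R x y \<longleftrightarrow> R a y}"] exI[of _ "{y \<in> Y. R a y}"]) blast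
  qed auto
next
  assume ?product
  then show ?agree
    by auto
qed

lemma (in tournament) bi_join_iff_agreement:
  "bi_join T X Y \<longleftrightarrow> bipartition (pverts T) X Y \<and>
    (\<forall>x\<in>X. \<forall>x'\<in>X. \<forall>y\<in>Y. \<forall>y'\<in>Y.
      ((x, y) \<in> parcs T \<longleftrightarrow> (x', y) \<in> parcs T) \<longleftrightarrow> ((x, y') \<in> parcs T \<longleftrightarrow> (x', y') \<in> parcs T))"
proof (cases "bipartition (pverts T) X Y")
  case True
  then have XY: "X \<subseteq> pverts T" "Y \<subseteq> pverts T" "X \<inter> Y = {}"
    by (auto simp: bipartition_def partition_on_def disjoint_def)
  then have nbhd: "in_nbhd T x \<inter> Y = Y - out_nbhd T x" if "x \<in> X" for x
    using arc_xor that unfolding in_nbhd_def out_nbhd_def by blast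
  have "(\<forall>x\<in>X\<^sub>1. out_nbhd T x \<inter> Y = Y\<^sub>1 \<and> in_nbhd T x \<inter> Y = Y - Y\<^sub>1) \<and>
      (\<forall>x\<in>X - X\<^sub>1. out_nbhd T x \<inter> Y = Y - Y\<^sub>1 \<and> in_nbhd T x \<inter> Y = Y\<^sub>1) \<longleftrightarrow>
      (\<forall>x\<in>X. \<forall>y\<in>Y. (x, y) \<in> parcs T \<longleftrightarrow> (x \<in> X\<^sub>1 \<longleftrightarrow> y \<in> Y\<^sub>1))"
    if "X\<^sub>1 \<subseteq> X" "Y\<^sub>1 \<subseteq> Y" for X\<^sub>1 Y\<^sub>1
  proof -
    have row: "out_nbhd T x \<inter> Y = Z \<and> in_nbhd T x \<inter> Y = Y - Z \<longleftrightarrow>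
        (\<forall>y\<in>Y. (x, y) \<in> parcs T \<longleftrightarrow> y \<in> Z)" if "x \<in> X" "Z \<subseteq> Y" for x Z
      using that unfolding nbhd[OF that(1)] out_nbhd_def by blast
    have "out_nbhd T x \<inter> Y = Y\<^sub>1 \<and> in_nbhd T x \<inter> Y = Y - Y\<^sub>1 \<longleftrightarrow>
        (\<forall>y\<in>Y. (x, y) \<in> parcs T \<longleftrightarrow> y \<in> Y\<^sub>1)"
      "out_nbhd T x \<inter> Y = Y - Y\<^sub>1 \<and> in_nbhd T x \<inter> Y = Y\<^sub>1 \<longleftrightarrow>
        (\<forall>y\<in>Y. (x, y) \<in> parcs T \<longleftrightarrow> y \<notin> Y\<^sub>1)" if "x \<in> X" for x
      using row[OF that \<open>Y\<^sub>1 \<subseteq> Y\<close>] row[OF that, of "Y - Y\<^sub>1"] \<open>Y\<^sub>1 \<subseteq> Y\<close> by (auto simp: double_diff)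
    then show ?thesis
      using \<open>X\<^sub>1 \<subseteq> X\<close> by (simp add: subset_iff) blast
  qed
  then show ?thesis
    using True unfolding bi_join_def agreement_iff_product_form by (simp cong: conj_cong)
qed (simp add: bi_join_def)

section \<open>Bi-joins and HL-bipartitions\<close>

theorem proposition2:
  fixes n :: nat and T :: "nat pair_pre_digraph" and X Y :: "nat set"
  assumes "tournament T" and "pverts T = {1..n}"
    and "bipartition {1..n} X Y"
  shows "bi_join T X Y \<longleftrightarrow> HL_bipartition (seidel_mat n T) X Y"
proof -
  interpret tournament T by fact
  have XY: "X \<subseteq> {1..n}" "Y \<subseteq> {1..n}" "X \<inter> Y = {}" "Y \<inter> X = {}"
    using assms(3) by (auto simp: bipartition_def partition_on_def disjoint_def)
  have reverse: "(y, x) \<in> parcs T \<longleftrightarrow> (x, y) \<notin> parcs T" if "x \<in> X" "y \<in> Y" for x y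
    using arc_xor[of x y] that XY assms(2) by blast
  have "(\<forall>y\<in>Y. \<forall>y'\<in>Y. \<forall>x\<in>X. \<forall>x'\<in>X.
      ((y, x) \<in> parcs T \<longleftrightarrow> (y', x) \<in> parcs T) \<longleftrightarrow> ((y, x') \<in> parcs T \<longleftrightarrow> (y', x') \<in> parcs T)) \<longleftrightarrow>
    (\<forall>x\<in>X. \<forall>x'\<in>X. \<forall>y\<in>Y. \<forall>y'\<in>Y.
      ((x, y) \<in> parcs T \<longleftrightarrow> (x', y) \<in> parcs T) \<longleftrightarrow> ((x, y') \<in> parcs T \<longleftrightarrow> (x', y') \<in> parcs T))"
    by (simp add: reverse) blast
  moreover have "dim_row (seidel_mat n T) = n"
    by (simp add: seidel_mat_def)
  ultimately show ?thesis
    unfolding bi_join_iff_agreement HL_bipartition_def assms(2)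
      rank_block_seidel_mat_le_1_iff[OF XY(1-3)] rank_block_seidel_mat_le_1_iff[OF XY(2,1,4)]
    using assms(3) by simp
qed

end
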